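(* If $k\ge 4$ is an even integer and $G$ is a graph of order $n$, size $m$ and maximum degree $\Delta(G)\le k$, then $$\alpha'(G) \ge \left(\frac{k+2}{k^2+k+2}\right) m - \left(\frac{k-2}{k^2+k+2}\right) n,$$ unless one of the following holds: (a) $G$ is $k$-regular and $n=k+1$, in which case $\alpha'(G) \ge \left(\frac{k+2}{k^2+k+2}\right) m - \left(\frac{k-2}{k^2+k+2}\right) n - \frac{k+2}{k^2+k+2}$; (b) $G$ is $k$-regular and $n=k+3$, in which case $\alpha'(G) \ge \left(\frac{k+2}{k^2+k+2}\right) m - \left(\frac{k-2}{k^2+k+2}\right) n - \frac{4}{k^2+k+2}$; (c) $G$ is $4$-regular and $n=9$, in which case $\alpha'(G) \ge \left(\frac{k+2}{k^2+k+2}\right) m - \left(\frac{k-2}{k^2+k+2}\right) n - \frac{2}{k^2+k+2}$.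
   Context: Graphs are finite, simple and undirected. The order of a graph is its number of vertices and its size is its number of edges; $\Delta(G)$ is the maximum degree of a vertex of $G$. The matching number $\alpha'(G)$ is the maximum number of edges in a matching (a set of pairwise non-adjacent edges) of $G$.
   Formalization: G is additionally assumed connected; without this the claim fails, e.g. for k = 4 and G two disjoint copies of K_5 (n = 10, m = 20, matching number 4 < 100/22). Disconnected graphs with no exceptional component follow by summing over components. *)

theory Defs
  imports Complex_Main
begin

text \<open>Finite simple undirected graphs, given by a vertex set and a set of
  two-element subsets of it.\<close>

locale fin_simple_graph =
  fixes V :: "'a set" and E :: "'a set set"
  assumes finite_vertices: "finite V"
    and edges_two_sets: "e \<in> E \<Longrightarrow> e \<subseteq> V \<and> card e = 2"

definition degree :: "'a set set \<Rightarrow> 'a \<Rightarrow> nat" where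
  "degree E v = card {e \<in> E. v \<in> e}"

text \<open>The inserted \<open>0\<close> only makes the maximum well defined for the graph without vertices.\<close>

definition max_degree :: "'a set \<Rightarrow> 'a set set \<Rightarrow> nat" where
  "max_degree V E = Max (insert 0 (degree E ` V))"

definition regular_graph :: "nat \<Rightarrow> 'a set \<Rightarrow> 'a set set \<Rightarrow> bool" where
  "regular_graph r V E \<longleftrightarrow> (\<forall>v\<in>V. degree E v = r)"

text \<open>A path from \<open>u\<close> to \<open>v\<close> is expressed by the reflexive transitive closure of
  adjacency. The graph without vertices counts as connected.\<close>

definition connected_graph :: "'a set \<Rightarrow> 'a set set \<Rightarrow> bool" where
  "connected_graph V E \<longleftrightarrow> (\<forall>u\<in>V. \<forall>v\<in>V. (u, v) \<in> {(x, y). {x, y} \<in> E}\<^sup>*)"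

definition matching :: "'a set set \<Rightarrow> 'a set set \<Rightarrow> bool" where
  "matching E M \<longleftrightarrow> M \<subseteq> E \<and> (\<forall>e\<in>M. \<forall>f\<in>M. e \<noteq> f \<longrightarrow> e \<inter> f = {})"

definition matching_number :: "'a set set \<Rightarrow> nat" where
  "matching_number E = Max {card M | M. matching E M}"

end

theory Submission
  imports Defs
begin

text \<open>Induction on the order, for graphs in which every component has a vertex of degree
  below \<open>k\<close>. If some vertex lies in every maximum matching, deleting it lowers the
  matching number and creates new low-degree neighbours, and the weights are such that
  \<open>(k + 2) k - (k - 2) = k\<^sup>2 + k + 2\<close> pays exactly for it. Otherwise, by Gallai's lemma, a
  maximum matching misses at most one vertex of each component, and the bound is checked
  component by component: parity of the degree sum gives a deficiency of at least 2 in odd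
  components, which saves the needed \<open>k + 2\<close>. A connected \<open>k\<close>-regular graph falls under the
  induction after one deletion, or else is missed in at most one vertex; in that case the
  saving is unavailable, which produces the exceptions.\<close>

section \<open>Matchings and maximum matchings\<close>

definition maximum_matching :: "'a set set \<Rightarrow> 'a set set \<Rightarrow> bool" where
  "maximum_matching E M \<longleftrightarrow> matching E M \<and> card M = matching_number E"

definition adjacency :: "'a set set \<Rightarrow> ('a \<times> 'a) set" where
  "adjacency E = {(x, y). {x, y} \<in> E}"

lemma sym_rtrancl_adjacency: "sym ((adjacency E)\<^sup>*)"
  by (intro sym_rtrancl) (auto simp: adjacency_def sym_def insert_commute)

context fin_simple_graph
begin

lemma finite_edges: "finite E"
  using finite_vertices edges_two_sets by (auto intro!: finite_subset[of E "Pow V"])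

lemma edge_obtain:
  assumes "e \<in> E" "x \<in> e"
  obtains y where "e = {x, y}" "x \<noteq> y" "x \<in> V" "y \<in> V"
proof -
  have "card e = 2" "e \<subseteq> V" using edges_two_sets assms by auto
  then obtain a b where "e = {a, b}" "a \<noteq> b" by (auto simp: card_2_iff)
  then show thesis using that assms \<open>e \<subseteq> V\<close> by (cases "x = a") auto
qed

lemma finite_matching: "matching E M \<Longrightarrow> finite M"
  using finite_edges finite_subset by (auto simp: matching_def)

lemma finite_matching_sizes: "finite {card M |M. matching E M}"
proof -
  have "{card M |M. matching E M} \<subseteq> card ` Pow E"
    by (auto simp: matching_def)
  then show ?thesis using finite_edges finite_subset by blast
qed

lemma card_le_matching_number:
  assumes "matching E M"
  shows "card M \<le> matching_number E"
  unfolding matching_number_def using assms finite_matching_sizes by (auto intro!: Max_ge)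

lemma maximum_matching_exists: "\<exists>M. maximum_matching E M"
proof -
  have "matching E {}" by (simp add: matching_def)
  then have "{card M |M. matching E M} \<noteq> {}" by blast
  from Max_in[OF finite_matching_sizes this] show ?thesis
    by (auto simp: maximum_matching_def matching_number_def)
qed

lemma Union_matching_subset: "matching E M \<Longrightarrow> \<Union>M \<subseteq> V"
  using edges_two_sets by (auto simp: matching_def)

lemma card_Union_matching:
  assumes "matching E M"
  shows "card (\<Union>M) = 2 * card M"
proof -
  have two: "card e = 2" "finite e" if "e \<in> M" for e
    using that assms edges_two_sets finite_vertices
    by (auto simp: matching_def intro: finite_subset)
  have "card (\<Union>M) = sum card M"
    using assms two by (intro card_Union_disjoint) (auto simp: matching_def pairwise_def disjnt_def)
  also have "\<dots> = 2 * card M" using two by simp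
  finally show ?thesis .
qed

text \<open>An edge disjoint from \<open>\<Union>M\<close> could be added to
  \<open>M\<close>.\<close>

lemma maximum_matching_meets_edge:
  assumes "maximum_matching E M" "e \<in> E"
  shows "e \<inter> \<Union>M \<noteq> {}"
proof
  assume disj: "e \<inter> \<Union>M = {}"
  have M: "matching E M" using assms by (simp add: maximum_matching_def)
  have "e \<noteq> {}" using edges_two_sets assms by fastforce
  then have "e \<notin> M" using disj by auto
  have "matching E (insert e M)"
    using M disj assms(2) unfolding matching_def by blast
  then have "card (insert e M) \<le> matching_number E" by (rule card_le_matching_number)
  then show False
    using \<open>e \<notin> M\<close> finite_matching[OF M] assms(1) by (simp add: maximum_matching_def)
qed

section \<open>Gallai's lemma\<close>

text \<open>The disjunct \<open>u = v\<close> makes the relation reflexive, so that it can be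
  carried along paths by transitivity.\<close>

definition never_both_missed :: "'a \<Rightarrow> 'a \<Rightarrow> bool" where
  "never_both_missed u v \<longleftrightarrow>
     u = v \<or> (\<forall>M. maximum_matching E M \<longrightarrow> u \<in> \<Union>M \<or> v \<in> \<Union>M)"

text \<open>The exchange argument in Gallai's lemma: among the maximum matchings missing the
  middle vertex, one that overlaps most with a given maximum matching missing both ends
  could be improved.\<close>

lemma never_both_missed_trans:
  assumes missed: "\<exists>N. maximum_matching E N \<and> t \<notin> \<Union>N"
    and ut: "never_both_missed u t" and tv: "never_both_missed t v"
    and "u \<in> V" "v \<in> V" "t \<in> V"
  shows "never_both_missed u v"
proof (rule ccontr)
  assume "\<not> never_both_missed u v"
  then obtain M where "u \<noteq> v" and M: "maximum_matching E M" and uM: "u \<notin> \<Union>M" and vM: "v \<notin> \<Union>M"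
    by (auto simp: never_both_missed_def)
  have "u \<noteq> t" "t \<noteq> v"
    using ut tv \<open>\<not> never_both_missed u v\<close> by auto
  have MM: "matching E M" using M by (simp add: maximum_matching_def)
  define P where "P N \<longleftrightarrow> maximum_matching E N \<and> t \<notin> \<Union>N" for N
  obtain N0 where "P N0" using missed by (auto simp: P_def)
  moreover have "\<forall>N. P N \<longrightarrow> card (M \<inter> N) < Suc (card M)"
    using finite_matching[OF MM] by (auto intro: card_mono simp: less_Suc_eq_le)
  ultimately obtain N where "P N" and best: "\<And>N'. P N' \<Longrightarrow> card (M \<inter> N') \<le> card (M \<inter> N)"
    using ex_has_greatest_nat[of P N0 "\<lambda>N. card (M \<inter> N)" "Suc (card M)"] by blast
  then have N: "maximum_matching E N" and tN: "t \<notin> \<Union>N" by (auto simp: P_def)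
  have NN: "matching E N" using N by (simp add: maximum_matching_def)
  have finN: "finite (\<Union>N)" and finM: "finite (\<Union>M)"
    using Union_matching_subset NN MM finite_vertices finite_subset by blast+
  have uN: "u \<in> \<Union>N" and vN: "v \<in> \<Union>N"
    using ut tv N tN \<open>u \<noteq> t\<close> \<open>t \<noteq> v\<close> by (auto simp: never_both_missed_def)
  \<comment> \<open>\<open>M\<close> and \<open>N\<close> cover equally many vertices, and
    \<open>N\<close> covers \<open>u\<close> and \<open>v\<close>, which \<open>M\<close> misses.
    The inclusion would therefore give
    \<open>card (\<Union>M) + 2 \<le> card (\<Union>N) + 1\<close>. The vertex \<open>x\<close>
    obtained from this starts the exchange.\<close>
  have "\<not> \<Union>M \<subseteq> insert t (\<Union>N)"
  proof
    assume "\<Union>M \<subseteq> insert t (\<Union>N)"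
    then have "insert u (insert v (\<Union>M)) \<subseteq> insert t (\<Union>N)" using uN vN by auto
    then have "card (insert u (insert v (\<Union>M))) \<le> card (insert t (\<Union>N))"
      using finN by (intro card_mono) auto
    then show False
      using uM vM tN finM finN \<open>u \<noteq> v\<close> M N card_Union_matching[OF MM] card_Union_matching[OF NN]
      by (simp add: maximum_matching_def)
  qed
  then obtain x e where "e \<in> M" "x \<in> e" and xN: "x \<notin> \<Union>N" and "x \<noteq> t" by blast
  have "e \<in> E" using \<open>e \<in> M\<close> MM by (auto simp: matching_def)
  then obtain y where e: "e = {x, y}" "x \<noteq> y" using edge_obtain[OF _ \<open>x \<in> e\<close>] by blast
  have "y \<in> \<Union>N"
    using maximum_matching_meets_edge[OF N \<open>e \<in> E\<close>] xN e by auto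
  then obtain f where "f \<in> N" "y \<in> f" by blast
  \<comment> \<open>Swapping \<open>f\<close> for \<open>e\<close> keeps the size and still misses
    \<open>t\<close>. It gains \<open>e\<close> in the overlap with \<open>M\<close> and loses
    nothing there, as \<open>f\<close> shares \<open>y\<close> with \<open>e \<in> M\<close> and so
    is not in \<open>M\<close>.\<close>
  define N' where "N' = insert e (N - {f})"
  have "e \<notin> N" using xN e by auto
  have "e \<noteq> f" "e \<inter> f \<noteq> {}" using \<open>y \<in> f\<close> \<open>f \<in> N\<close> \<open>e \<notin> N\<close> e by auto
  then have "f \<notin> M"
    using MM \<open>e \<in> M\<close> by (meson matching_def)
  have "e \<inter> g = {}" if "g \<in> N - {f}" for g
  proof -
    have "g \<inter> f = {}" using NN that \<open>f \<in> N\<close> by (simp add: matching_def)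
    then show ?thesis using that xN \<open>y \<in> f\<close> e by auto
  qed
  then have "matching E N'"
    using NN \<open>e \<in> E\<close> by (auto simp: matching_def N'_def Int_commute)
  moreover have "card N' = card N"
    using \<open>e \<notin> N\<close> \<open>f \<in> N\<close> finite_matching[OF NN]
    by (simp add: N'_def card_Suc_Diff1 del: card_Diff_insert card_Diff_singleton)
  moreover have "t \<notin> \<Union>N'"
    using tN \<open>x \<noteq> t\<close> \<open>y \<in> \<Union>N\<close> e by (auto simp: N'_def)
  ultimately have "P N'" using N by (simp add: P_def maximum_matching_def)
  moreover have "M \<inter> N' = insert e (M \<inter> N)"
    using \<open>f \<notin> M\<close> \<open>e \<in> M\<close> by (auto simp: N'_def)
  ultimately show False
    using best[of N'] \<open>e \<notin> N\<close> finite_matching[OF MM] by simp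
qed

text \<open>Adjacent vertices are related because a maximum matching meets every edge; transitivity
  extends this along a path. Membership \<open>v \<in> V\<close> is carried through the induction
  because transitivity asks for vertices.\<close>

lemma never_both_missed_connected:
  assumes missed: "\<And>t. t \<in> V \<Longrightarrow> \<exists>N. maximum_matching E N \<and> t \<notin> \<Union>N"
    and "(u, v) \<in> (adjacency E)\<^sup>*" "u \<in> V"
  shows "v \<in> V \<and> never_both_missed u v"
  using assms(2)
proof (induction rule: rtrancl_induct)
  case base
  then show ?case using \<open>u \<in> V\<close> by (simp add: never_both_missed_def)
next
  case (step y z)
  have yz: "{y, z} \<in> E" using step by (simp add: adjacency_def)
  then have "z \<in> V" using edges_two_sets by auto
  moreover have "never_both_missed y z"
    using maximum_matching_meets_edge[OF _ yz] by (auto simp: never_both_missed_def)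
  ultimately show ?case
    using step.IH never_both_missed_trans[of y u z] missed \<open>u \<in> V\<close> by blast
qed

section \<open>Components, degree sums and near-perfect matchings\<close>

text \<open>The closure is reflexive on the whole type, so it is restricted to
  \<open>V \<times> V\<close> to become an equivalence on \<open>V\<close>.\<close>

definition components :: "'a set set" where
  "components = V // ((adjacency E)\<^sup>* \<inter> V \<times> V)"

lemma equiv_reachable: "equiv V ((adjacency E)\<^sup>* \<inter> V \<times> V)"
proof (rule equivI)
  show "sym ((adjacency E)\<^sup>* \<inter> V \<times> V)"
    using sym_rtrancl_adjacency[of E] by (intro sym_Int) (auto simp: sym_def)
  show "trans ((adjacency E)\<^sup>* \<inter> V \<times> V)"
    using trans_rtrancl[of "adjacency E"] by (intro trans_Int) (auto simp: trans_def)
qed (auto simp: refl_on_def)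

lemma component_subset: "C \<in> components \<Longrightarrow> C \<subseteq> V"
  using equiv_reachable Union_quotient unfolding components_def by blast

lemma component_nonempty: "C \<in> components \<Longrightarrow> C \<noteq> {}"
  using equiv_reachable in_quotient_imp_non_empty unfolding components_def by blast

lemma finite_component: "C \<in> components \<Longrightarrow> finite C"
  using component_subset finite_vertices finite_subset by blast

lemma Union_components: "\<Union>components = V"
  using equiv_reachable Union_quotient unfolding components_def by blast

lemma finite_components: "finite components"
  using Union_components finite_vertices by (metis finite_UnionD)

lemma components_disjoint: "C \<in> components \<Longrightarrow> C' \<in> components \<Longrightarrow> C \<noteq> C' \<Longrightarrow> C \<inter> C' = {}"
  unfolding components_def by (metis quotient_disj[OF equiv_reachable])

lemma component_iff:
  assumes "C \<in> components" "x \<in> C" "y \<in> V"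
  shows "y \<in> C \<longleftrightarrow> (x, y) \<in> (adjacency E)\<^sup>*"
proof -
  let ?r = "(adjacency E)\<^sup>* \<inter> V \<times> V"
  have C: "C \<in> V // ?r" using assms components_def by simp
  have "x \<in> V" using component_subset assms by blast
  show ?thesis
  proof
    assume "y \<in> C"
    then have "(x, y) \<in> ?r"
      using quotient_eq_iff[OF equiv_reachable C C \<open>x \<in> C\<close>, of y] by simp
    then show "(x, y) \<in> (adjacency E)\<^sup>*" by blast
  next
    assume "(x, y) \<in> (adjacency E)\<^sup>*"
    then have "(x, y) \<in> ?r" using \<open>x \<in> V\<close> \<open>y \<in> V\<close> by blast
    then show "y \<in> C" by (rule in_quotient_imp_closed[OF equiv_reachable C \<open>x \<in> C\<close>])
  qed
qed

lemma component_closed: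
  assumes "C \<in> components" "e \<in> E" "x \<in> e" "x \<in> C"
  shows "e \<subseteq> C"
proof -
  obtain y where y: "e = {x, y}" "y \<in> V" by (rule edge_obtain[OF assms(2,3)])
  then have "(x, y) \<in> (adjacency E)\<^sup>*" using assms by (auto simp: adjacency_def)
  then show ?thesis using component_iff[of C x y] assms y by simp
qed

text \<open>Every edge is nonempty and lies in exactly one component. The set \<open>F\<close> is
  kept general to serve both for \<open>E\<close> and for a maximum matching.\<close>

lemma card_edges_components:
  assumes "F \<subseteq> E"
  shows "card F = (\<Sum>C\<in>components. card {e \<in> F. e \<subseteq> C})"
proof -
  have ne: "e \<noteq> {}" if "e \<in> F" for e using that assms edges_two_sets by fastforce
  have "\<exists>C\<in>components. e \<subseteq> C" if "e \<in> F" for e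
  proof -
    obtain x where "x \<in> e" using ne \<open>e \<in> F\<close> by auto
    then have "x \<in> V" using that assms edges_two_sets by blast
    then obtain C where "C \<in> components" "x \<in> C" using Union_components by blast
    then show ?thesis using component_closed[of C e x] that assms \<open>x \<in> e\<close> by blast
  qed
  then have "F = (\<Union>C\<in>components. {e \<in> F. e \<subseteq> C})" by blast
  then have "card F = card (\<Union>C\<in>components. {e \<in> F. e \<subseteq> C})" by simp
  also have "\<dots> = (\<Sum>C\<in>components. card {e \<in> F. e \<subseteq> C})"
  proof (rule card_UN_disjoint)
    show "\<forall>C\<in>components. finite {e \<in> F. e \<subseteq> C}"
      using finite_subset[OF assms finite_edges] by simp
    show "\<forall>C\<in>components. \<forall>C'\<in>components. C \<noteq> C' \<longrightarrow> {e \<in> F. e \<subseteq> C} \<inter> {e \<in> F. e \<subseteq> C'} = {}"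
    proof (intro ballI impI equals0I)
      fix C C' e assume C: "C \<in> components" "C' \<in> components" "C \<noteq> C'"
        and "e \<in> {e \<in> F. e \<subseteq> C} \<inter> {e \<in> F. e \<subseteq> C'}"
      then have "e \<in> F" "e \<subseteq> C \<inter> C'" by auto
      then show False using components_disjoint[OF C] ne by auto
    qed
  qed (rule finite_components)
  finally show ?thesis .
qed

lemma card_vertices_components: "card V = (\<Sum>C\<in>components. card C)"
  using card_Union_disjoint[of components] components_disjoint finite_component Union_components
  by (auto simp: pairwise_def disjnt_def)

text \<open>Handshake by double counting incidences: all edges at a vertex of \<open>C\<close> stay
  inside \<open>C\<close>.\<close>

lemma sum_degree_component:
  assumes "C \<in> components"
  shows "(\<Sum>v\<in>C. degree E v) = 2 * card {e \<in> E. e \<subseteq> C}"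
proof -
  let ?F = "{e \<in> E. e \<subseteq> C}"
  have "{e \<in> E. v \<in> e} = {e \<in> ?F. v \<in> e}" if "v \<in> C" for v
    using component_closed assms that by blast
  then have "(\<Sum>v\<in>C. degree E v) = (\<Sum>v\<in>C. card {e \<in> ?F. v \<in> e})"
    by (simp add: degree_def)
  also have "\<dots> = 2 * card ?F"
  proof (rule sum_multicount)
    show "\<forall>e\<in>?F. card {v \<in> C. v \<in> e} = 2"
    proof
      fix e assume "e \<in> ?F"
      then have "{v \<in> C. v \<in> e} = e" by auto
      then show "card {v \<in> C. v \<in> e} = 2" using \<open>e \<in> ?F\<close> edges_two_sets by simp
    qed
  qed (use assms finite_component finite_edges in auto)
  finally show ?thesis .
qed

lemma degree_le_component:
  assumes "C \<in> components" "v \<in> C"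
  shows "degree E v \<le> card C - 1"
proof -
  have "{e \<in> E. v \<in> e} \<subseteq> (\<lambda>w. {v, w}) ` (C - {v})"
  proof
    fix e assume "e \<in> {e \<in> E. v \<in> e}"
    then have e: "e \<in> E" "v \<in> e" by auto
    obtain y where "e = {v, y}" "v \<noteq> y" by (rule edge_obtain[OF e])
    moreover from this have "y \<in> C" using component_closed[OF assms(1) e] assms by auto
    ultimately show "e \<in> (\<lambda>w. {v, w}) ` (C - {v})" by auto
  qed
  then have "degree E v \<le> card (C - {v})"
    unfolding degree_def using finite_component[OF assms(1)] by (intro surj_card_le) auto
  then show ?thesis using assms finite_component by simp
qed

lemma card_edges_component_le:
  assumes "C \<in> components"
  shows "2 * card {e \<in> E. e \<subseteq> C} \<le> card C * (card C - 1)"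
  using sum_bounded_above[of C "degree E" "card C - 1"] degree_le_component[OF assms]
    sum_degree_component[OF assms] by simp

text \<open>By Gallai's lemma two vertices of \<open>C\<close> missed by \<open>M\<close> must
  coincide. The remaining vertices of \<open>C\<close> are covered by edges of \<open>M\<close>
  inside \<open>C\<close>, two per edge.\<close>

lemma matching_component_near_perfect:
  assumes missed: "\<And>t. t \<in> V \<Longrightarrow> \<exists>N. maximum_matching E N \<and> t \<notin> \<Union>N"
    and M: "maximum_matching E M" and C: "C \<in> components"
  shows "card C \<le> 2 * card {e \<in> M. e \<subseteq> C} + 1"
proof -
  let ?M = "{e \<in> M. e \<subseteq> C}"
  have MM: "matching E M" using M by (simp add: maximum_matching_def)
  have "x = y" if "x \<in> C - \<Union>M" "y \<in> C - \<Union>M" for x y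
  proof -
    have "x \<in> V" "y \<in> V" using component_subset C that by auto
    then have "(x, y) \<in> (adjacency E)\<^sup>*" using component_iff that C by auto
    then have "never_both_missed x y"
      using never_both_missed_connected missed \<open>x \<in> V\<close> by blast
    then show ?thesis using M that unfolding never_both_missed_def by blast
  qed
  then have one: "card (C - \<Union>M) \<le> 1"
    using finite_component[OF C] by (auto simp: card_le_Suc0_iff_eq)
  have "C \<subseteq> \<Union>?M \<union> (C - \<Union>M)"
  proof
    fix x assume "x \<in> C"
    have "e \<subseteq> C" if "e \<in> M" "x \<in> e" for e
      using component_closed[OF C _ \<open>x \<in> e\<close> \<open>x \<in> C\<close>] MM that by (auto simp: matching_def)
    then show "x \<in> \<Union>?M \<union> (C - \<Union>M)" using \<open>x \<in> C\<close> by blast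
  qed
  moreover have mm: "matching E ?M" using MM unfolding matching_def by blast
  moreover have "finite (\<Union>?M)"
    using Union_matching_subset mm finite_vertices finite_subset by blast
  ultimately have "card C \<le> card (\<Union>?M \<union> (C - \<Union>M))"
    using finite_component[OF C] by (intro card_mono) auto
  also have "\<dots> \<le> card (\<Union>?M) + card (C - \<Union>M)" by (rule card_Un_le)
  also have "\<dots> \<le> 2 * card ?M + 1" using one card_Union_matching[OF mm] by simp
  finally show ?thesis .
qed

lemma component_connected:
  assumes "connected_graph V E" "V \<noteq> {}"
  shows "components = {V}"
proof -
  have "C = V" if "C \<in> components" for C
  proof -
    obtain x where "x \<in> C" using component_nonempty \<open>C \<in> components\<close> by blast
    then show ?thesis
      using that assms(1) component_iff[OF that] component_subset[OF that]
      by (auto simp: connected_graph_def adjacency_def)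
  qed
  then show ?thesis using Union_components \<open>V \<noteq> {}\<close> by auto
qed

section \<open>Deleting a vertex\<close>

lemma delete_vertex: "fin_simple_graph (V - {v}) {e \<in> E. v \<notin> e}"
  using finite_vertices edges_two_sets by unfold_locales blast+

lemma degree_delete_vertex_le: "degree {e \<in> E. v \<notin> e} w \<le> degree E w"
  unfolding degree_def using finite_edges by (intro card_mono) auto

lemma degree_delete_neighbour:
  assumes "{w, v} \<in> E"
  shows "degree {e \<in> E. v \<notin> e} w < degree E w"
  unfolding degree_def
proof (rule psubset_card_mono)
  have "{w, v} \<in> {e \<in> E. w \<in> e}" "{w, v} \<notin> {e \<in> {e \<in> E. v \<notin> e}. w \<in> e}"
    using assms by simp_all
  then have "{e \<in> {e \<in> E. v \<notin> e}. w \<in> e} \<noteq> {e \<in> E. w \<in> e}" by metis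
  moreover have "{e \<in> {e \<in> E. v \<notin> e}. w \<in> e} \<subseteq> {e \<in> E. w \<in> e}" by auto
  ultimately show "{e \<in> {e \<in> E. v \<notin> e}. w \<in> e} \<subset> {e \<in> E. w \<in> e}" by (rule psubsetI[rotated])
qed (use finite_edges in simp)

lemma card_delete_vertex: "card E = card {e \<in> E. v \<notin> e} + degree E v"
proof -
  have "E = {e \<in> E. v \<notin> e} \<union> {e \<in> E. v \<in> e}" by auto
  then have "card E = card ({e \<in> E. v \<notin> e} \<union> {e \<in> E. v \<in> e})" by simp
  also have "\<dots> = card {e \<in> E. v \<notin> e} + degree E v"
    unfolding degree_def using finite_edges by (intro card_Un_disjoint) auto
  finally show ?thesis .
qed

text \<open>A maximum matching of the smaller graph is a matching of \<open>E\<close> that misses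
  \<open>v\<close>, hence not a maximum one of \<open>E\<close>.\<close>

lemma matching_number_delete_vertex:
  assumes "\<And>M. maximum_matching E M \<Longrightarrow> v \<in> \<Union>M"
  shows "matching_number {e \<in> E. v \<notin> e} < matching_number E"
proof -
  interpret D: fin_simple_graph "V - {v}" "{e \<in> E. v \<notin> e}" by (rule delete_vertex)
  obtain M where M: "maximum_matching {e \<in> E. v \<notin> e} M" using D.maximum_matching_exists by blast
  then have "matching E M" "v \<notin> \<Union>M" by (auto simp: maximum_matching_def matching_def)
  moreover from this have "card M \<noteq> matching_number E"
    using assms[of M] by (auto simp: maximum_matching_def)
  ultimately show ?thesis
    using card_le_matching_number[of M] M by (simp add: maximum_matching_def)
qed

text \<open>Follow the path from \<open>w\<close> to \<open>z\<close>. If it runs into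
  \<open>v\<close>, the vertex just before loses an edge and drops below \<open>k\<close>; otherwise
  the path survives and \<open>z\<close> still has low degree. The alternative \<open>z = v\<close>
  serves the regular case.\<close>

lemma delete_vertex_reaches_low_degree:
  assumes deg: "\<And>x. x \<in> V \<Longrightarrow> degree E x \<le> k"
    and low: "z = v \<or> degree E z < k" and "(w, z) \<in> (adjacency E)\<^sup>*" and "w \<in> V - {v}"
  shows "\<exists>y\<in>V - {v}. (w, y) \<in> (adjacency {e \<in> E. v \<notin> e})\<^sup>* \<and> degree {e \<in> E. v \<notin> e} y < k"
  using assms(3,4)
proof (induction rule: converse_rtrancl_induct)
  case base
  then have "degree {e \<in> E. v \<notin> e} z < k"
    using low degree_delete_vertex_le[of v z] by simp
  then show ?case using base by blast
next
  case (step x y)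
  have xy: "{x, y} \<in> E" using step by (simp add: adjacency_def)
  show ?case
  proof (cases "y = v")
    case True
    then have "degree {e \<in> E. v \<notin> e} x < k"
      using degree_delete_neighbour[of x v] xy deg[of x] step.prems by simp
    then show ?thesis using step.prems by blast
  next
    case False
    then have "y \<in> V - {v}" using xy edges_two_sets by blast
    moreover have "(x, y) \<in> adjacency {e \<in> E. v \<notin> e}"
      using xy False step.prems by (auto simp: adjacency_def)
    ultimately show ?thesis using step.IH by (meson converse_rtrancl_into_rtrancl)
  qed
qed

end

section \<open>The integer bound and its arithmetic\<close>

text \<open>The claimed bound multiplied by \<open>k^2 + k + 2\<close>; integers avoid both division
  and truncated subtraction.\<close>

definition size_bound :: "nat \<Rightarrow> 'a set \<Rightarrow> 'a set set \<Rightarrow> bool" where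
  "size_bound k V E \<longleftrightarrow>
     (int k + 2) * int (card E)
       \<le> ((int k)\<^sup>2 + int k + 2) * int (matching_number E) + (int k - 2) * int (card V)"

text \<open>Restoring \<open>v\<close> adds at most \<open>(k + 2) * k\<close> on the left and at
  least \<open>(k^2 + k + 2) + (k - 2)\<close> on the right, which is the same number.\<close>

lemma (in fin_simple_graph) size_bound_delete_vertex:
  assumes "v \<in> V" "degree E v \<le> k"
    and "\<And>M. maximum_matching E M \<Longrightarrow> v \<in> \<Union>M"
    and "size_bound k (V - {v}) {e \<in> E. v \<notin> e}"
  shows "size_bound k V E"
proof -
  let ?E = "{e \<in> E. v \<notin> e}"
  have cV: "int (card V) = int (card (V - {v})) + 1"
    using assms(1) finite_vertices by (metis card_Suc_Diff1 of_nat_Suc add.commute)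
  have "((int k)\<^sup>2 + int k + 2) * (int (matching_number ?E) + 1)
      \<le> ((int k)\<^sup>2 + int k + 2) * int (matching_number E)"
    using matching_number_delete_vertex[OF assms(3)] by (intro mult_left_mono) auto
  moreover have "(int k + 2) * int (card E) \<le> (int k + 2) * (int (card ?E) + int k)"
    using card_delete_vertex[of v] assms(2) by (intro mult_left_mono) auto
  ultimately show ?thesis
    using assms(4) unfolding size_bound_def cV by (simp add: algebra_simps power2_eq_square)
qed

text \<open>Here and below \<open>a\<close>, \<open>b\<close>, \<open>c\<close> stand for the
  numbers of matching edges, edges and vertices of a component. A perfect matching leaves a surplus
  of \<open>(k - 2) * c\<close> in the doubled inequality.\<close>

lemma even_order_bound:
  fixes a b c k :: int
  assumes "4 \<le> k" "c \<le> 2 * a" "2 * b \<le> k * c" "0 \<le> c"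
  shows "(k + 2) * b \<le> (k\<^sup>2 + k + 2) * a + (k - 2) * c"
proof -
  have "(k + 2) * (2 * b) \<le> (k + 2) * (k * c)" using assms by (intro mult_left_mono) auto
  moreover have "(k\<^sup>2 + k + 2) * c \<le> (k\<^sup>2 + k + 2) * (2 * a)"
    using assms by (intro mult_left_mono) auto
  moreover have "0 \<le> (k - 2) * c" using assms by simp
  ultimately show ?thesis by (simp add: algebra_simps power2_eq_square)
qed

text \<open>Here \<open>d\<close> is the degree deficiency \<open>k * c - 2 * b\<close>: at least 2 if the component is not
  \<open>k\<close>-regular, and 0 if it is.\<close>

lemma odd_order_bound:
  fixes a b c d k :: int
  assumes "4 \<le> k" "c \<le> 2 * a + 1" "2 * b \<le> k * c - d"
  shows "2 * ((k + 2) * b) + (k - 2) * (c - k - 1)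
    \<le> 2 * ((k\<^sup>2 + k + 2) * a + (k - 2) * c) + (k + 2) * (2 - d)"
proof -
  have "(k + 2) * (2 * b) \<le> (k + 2) * (k * c - d)" using assms by (intro mult_left_mono) auto
  moreover have "(k\<^sup>2 + k + 2) * (c - 1) \<le> (k\<^sup>2 + k + 2) * (2 * a)"
    using assms by (intro mult_left_mono) auto
  \<comment> \<open>After inserting both bounds the two sides agree as polynomials, so no slack is
    lost.\<close>
  ultimately show ?thesis by (simp add: algebra_simps power2_eq_square)
qed

lemma small_order_bound:
  fixes a b c k :: int
  assumes "4 \<le> k" "c \<le> 2 * a + 1" "2 * b \<le> c * (c - 1)" "1 \<le> c" "c \<le> k - 1"
  shows "(k + 2) * b \<le> (k\<^sup>2 + k + 2) * a + (k - 2) * c"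
proof -
  have "(k + 2) * (2 * b) \<le> (k + 2) * (c * (c - 1))" using assms by (intro mult_left_mono) auto
  moreover have "(k\<^sup>2 + k + 2) * (c - 1) \<le> (k\<^sup>2 + k + 2) * (2 * a)"
    using assms by (intro mult_left_mono) auto
  \<comment> \<open>This encodes \<open>(k + 2) * c \<le> (k + 2) * (k - 1) = k^2 + k - 2\<close>,
    multiplied by \<open>c - 1\<close>; the right side is below \<open>k^2 + k + 2\<close>.\<close>
  moreover have "0 \<le> (c - 1) * ((k + 2) * (k - 1 - c))" using assms by simp
  ultimately have "2 * ((k + 2) * b) \<le> 2 * ((k\<^sup>2 + k + 2) * a)"
    using assms(4) by (simp add: algebra_simps power2_eq_square)
  moreover have "0 \<le> (k - 2) * c" using assms by simp
  ultimately show ?thesis by linarith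
qed

text \<open>Three cases: even order gives a perfect matching; odd order below \<open>k\<close> is
  settled by the edge count of a complete graph; odd order above \<open>k\<close> uses the degree
  deficiency. As \<open>k\<close> is even, an odd order never equals \<open>k\<close>.\<close>

lemma component_bound:
  fixes a b c k :: nat
  assumes "4 \<le> k" "even k" "1 \<le> c" "c \<le> 2 * a + 1" "2 * b \<le> c * (c - 1)" "2 * b < k * c"
  shows "(int k + 2) * int b \<le> ((int k)\<^sup>2 + int k + 2) * int a + (int k - 2) * int c"
proof (cases "even c")
  case True
  then have "c \<le> 2 * a" using assms(4) by presburger
  moreover have "2 * int b \<le> int k * int c" using assms(6) by (metis of_nat_le_iff of_nat_mult of_nat_numeral less_imp_le)
  ultimately show ?thesis using assms by (intro even_order_bound) auto
next
  case odd: False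
  show ?thesis
  proof (cases "c \<le> k")
    case True
    then have "c < k" using odd assms(2) by (metis le_neq_implies_less)
    moreover have "2 * int b \<le> int c * (int c - 1)"
      using assms(3,5) by (metis of_nat_1 of_nat_diff of_nat_le_iff of_nat_mult of_nat_numeral)
    ultimately show ?thesis using assms by (intro small_order_bound) auto
  next
    case False
    have "even (k * c)" using assms(2) by simp
    \<comment> \<open>Both sides of the strict inequality are even, so they differ by at least
      2.\<close>
    then have "2 * b + 2 \<le> k * c" using assms(6) by presburger
    then have "2 * int b \<le> int k * int c - 2"
      by (simp flip: of_nat_le_iff[where ?'a = int])
    then have "2 * ((int k + 2) * int b) + (int k - 2) * (int c - int k - 1)
        \<le> 2 * (((int k)\<^sup>2 + int k + 2) * int a + (int k - 2) * int c) + (int k + 2) * (2 - 2)"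
      using assms by (intro odd_order_bound) auto
    moreover have "0 \<le> (int k - 2) * (int c - int k - 1)" using False assms(1) by simp
    \<comment> \<open>Stated for arbitrary integers so that the products stay unexpanded.\<close>
    moreover have "x \<le> y" if "2 * x + p \<le> 2 * y + q * (2 - 2)" "0 \<le> p" for p q x y :: int
      using that by simp
    ultimately show ?thesis by blast
  qed
qed

section \<open>Induction over graphs without a \<open>k\<close>-regular component\<close>

text \<open>Deleting a vertex may disconnect the graph but preserves the reachability of a
  low-degree vertex, so this condition, rather than connectedness, is what the induction
  carries.\<close>

lemma size_bound_reaches_low_degree:
  assumes "4 \<le> k" "even k"
  shows "fin_simple_graph V E \<Longrightarrow> (\<And>v. v \<in> V \<Longrightarrow> degree E v \<le> k) \<Longrightarrow>
    (\<And>v. v \<in> V \<Longrightarrow> \<exists>w\<in>V. (v, w) \<in> (adjacency E)\<^sup>* \<and> degree E w < k) \<Longrightarrow> size_bound k V E"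
proof (induction "card V" arbitrary: V E rule: less_induct)
  case less
  interpret fin_simple_graph V E by (rule less.prems)
  note deg = less.prems(2) and low = less.prems(3)
  show ?case
  proof (cases "\<exists>v\<in>V. \<forall>M. maximum_matching E M \<longrightarrow> v \<in> \<Union>M")
    case True
    then obtain v where v: "v \<in> V" and ess: "\<And>M. maximum_matching E M \<Longrightarrow> v \<in> \<Union>M" by blast
    have "size_bound k (V - {v}) {e \<in> E. v \<notin> e}"
    proof (rule less.hyps)
      show "card (V - {v}) < card V" using v finite_vertices by (rule card_Diff1_less[rotated])
      show "fin_simple_graph (V - {v}) {e \<in> E. v \<notin> e}" by (rule delete_vertex)
      show "degree {e \<in> E. v \<notin> e} w \<le> k" if "w \<in> V - {v}" for w
        using deg[of w] degree_delete_vertex_le[of v w] that by simp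
      show "\<exists>y\<in>V - {v}. (w, y) \<in> (adjacency {e \<in> E. v \<notin> e})\<^sup>* \<and> degree {e \<in> E. v \<notin> e} y < k"
        if "w \<in> V - {v}" for w
        using low[of w] that delete_vertex_reaches_low_degree[OF deg] by blast
    qed
    then show ?thesis using size_bound_delete_vertex[OF v deg[OF v] ess] by blast
  next
    case False
    then have missed: "\<And>t. t \<in> V \<Longrightarrow> \<exists>N. maximum_matching E N \<and> t \<notin> \<Union>N" by blast
    \<comment> \<open>One maximum matching of the whole graph is fixed; its edges split over the
      components, so the local bounds add up.\<close>
    obtain M where M: "maximum_matching E M" using maximum_matching_exists by blast
    then have "M \<subseteq> E" by (simp add: maximum_matching_def matching_def)
    have comp: "(int k + 2) * int (card {e \<in> E. e \<subseteq> C})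
        \<le> ((int k)\<^sup>2 + int k + 2) * int (card {e \<in> M. e \<subseteq> C}) + (int k - 2) * int (card C)"
      if C: "C \<in> components" for C
    proof (rule component_bound[OF assms])
      obtain x where "x \<in> C" using component_nonempty[OF C] by blast
      then have "x \<in> V" using component_subset[OF C] by blast
      then obtain w where "w \<in> V" "(x, w) \<in> (adjacency E)\<^sup>*" and dw: "degree E w < k" using low by blast
      then have "w \<in> C" using component_iff[OF C \<open>x \<in> C\<close>] by blast
      \<comment> \<open>The low-degree vertex \<open>w\<close> makes the degree sum strictly smaller
        than in a \<open>k\<close>-regular component.\<close>
      have "(\<Sum>v\<in>C. degree E v) < (\<Sum>v\<in>C. k)"
        using \<open>w \<in> C\<close> dw deg component_subset[OF C] finite_component[OF C]
        by (intro sum_strict_mono_ex1) auto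
      then show "2 * card {e \<in> E. e \<subseteq> C} < k * card C"
        using sum_degree_component[OF C] by (simp add: mult.commute)
      show "1 \<le> card C"
        using \<open>x \<in> C\<close> finite_component[OF C] by (auto simp: Suc_le_eq card_gt_0_iff)
    qed (use C card_edges_component_le matching_component_near_perfect[OF missed M] in auto)
    have "(int k + 2) * int (card E) = (\<Sum>C\<in>components. (int k + 2) * int (card {e \<in> E. e \<subseteq> C}))"
      using card_edges_components[of E] by (simp add: sum_distrib_left)
    also have "\<dots> \<le> (\<Sum>C\<in>components. ((int k)\<^sup>2 + int k + 2) * int (card {e \<in> M. e \<subseteq> C})
        + (int k - 2) * int (card C))"
      by (rule sum_mono) (rule comp)
    also have "\<dots> = ((int k)\<^sup>2 + int k + 2) * int (card M) + (int k - 2) * int (card V)"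
      using card_edges_components[OF \<open>M \<subseteq> E\<close>] card_vertices_components
      by (simp add: sum.distrib sum_distrib_left)
    finally show ?thesis using M by (simp add: size_bound_def maximum_matching_def)
  qed
qed

section \<open>Connected graphs\<close>

lemma (in fin_simple_graph) connected_not_regular_size_bound:
  assumes "4 \<le> k" "even k" "connected_graph V E" "\<And>v. v \<in> V \<Longrightarrow> degree E v \<le> k"
    and "\<not> regular_graph k V E"
  shows "size_bound k V E"
proof (rule size_bound_reaches_low_degree[OF assms(1,2)])
  obtain w where "w \<in> V" "degree E w < k"
    using assms(4,5) by (force simp: regular_graph_def order.order_iff_strict)
  then show "\<exists>w\<in>V. (v, w) \<in> (adjacency E)\<^sup>* \<and> degree E w < k" if "v \<in> V" for v
    using assms(3) that by (auto simp: connected_graph_def adjacency_def)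
qed (use assms fin_simple_graph_axioms in auto)

text \<open>If some vertex is in every maximum matching, deleting it leads to the non-regular case.
  Otherwise the graph is one near-perfectly matched component of deficiency 0, and for odd order the
  doubled inequality may fail by \<open>2 * (k + 2)\<close> less the term growing with the
  order.\<close>

lemma (in fin_simple_graph) connected_regular_size_bound:
  assumes "4 \<le> k" "even k" "connected_graph V E" "regular_graph k V E"
  shows "size_bound k V E \<or> (odd (card V) \<and> k + 1 \<le> card V \<and>
    2 * ((int k + 2) * int (card E)) + (int k - 2) * (int (card V) - int k - 1)
    \<le> 2 * (((int k)\<^sup>2 + int k + 2) * int (matching_number E) + (int k - 2) * int (card V))
       + 2 * (int k + 2))"
proof (cases "\<exists>v\<in>V. \<forall>M. maximum_matching E M \<longrightarrow> v \<in> \<Union>M")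
  case True
  then obtain v where v: "v \<in> V" and ess: "\<And>M. maximum_matching E M \<Longrightarrow> v \<in> \<Union>M" by blast
  have deg: "degree E w \<le> k" if "w \<in> V" for w using assms(4) that by (simp add: regular_graph_def)
  have "size_bound k (V - {v}) {e \<in> E. v \<notin> e}"
  proof (rule size_bound_reaches_low_degree[OF assms(1,2)])
    show "fin_simple_graph (V - {v}) {e \<in> E. v \<notin> e}" by (rule delete_vertex)
    show "degree {e \<in> E. v \<notin> e} w \<le> k" if "w \<in> V - {v}" for w
      using deg[of w] degree_delete_vertex_le[of v w] that by simp
    show "\<exists>y\<in>V - {v}. (w, y) \<in> (adjacency {e \<in> E. v \<notin> e})\<^sup>* \<and> degree {e \<in> E. v \<notin> e} y < k"
      if "w \<in> V - {v}" for w
    proof (rule delete_vertex_reaches_low_degree[OF deg])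
      \<comment> \<open>The target is \<open>v\<close> itself: its neighbours acquire degree below
        \<open>k\<close>.\<close>
      show "(w, v) \<in> (adjacency E)\<^sup>*"
        using assms(3) that v by (auto simp: connected_graph_def adjacency_def)
    qed (use that in auto)
  qed
  then show ?thesis using size_bound_delete_vertex[OF v deg[OF v] ess] by blast
next
  case False
  then have missed: "\<And>t. t \<in> V \<Longrightarrow> \<exists>N. maximum_matching E N \<and> t \<notin> \<Union>N" by blast
  show ?thesis
  \<comment> \<open>The empty graph is vacuously connected and regular but has no component.\<close>
  proof (cases "V = {}")
    case True
    then have "E = {}" using edges_two_sets by fastforce
    then show ?thesis using True by (simp add: size_bound_def)
  next
    case nonempty: False
    then have C: "V \<in> components" using component_connected[OF assms(3)] by simp
    obtain M where M: "maximum_matching E M" using maximum_matching_exists by blast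
    then have "{e \<in> M. e \<subseteq> V} = M" "{e \<in> E. e \<subseteq> V} = E"
      using edges_two_sets by (auto simp: maximum_matching_def matching_def)
    then have near: "card V \<le> 2 * matching_number E + 1" and size: "2 * card E = k * card V"
      using matching_component_near_perfect[OF missed M C] sum_degree_component[OF C] M assms(4)
      by (auto simp: maximum_matching_def regular_graph_def mult.commute)
    have size': "2 * int (card E) = int k * int (card V)"
      using size by (metis of_nat_mult of_nat_numeral)
    show ?thesis
    proof (cases "even (card V)")
      case True
      then have "card V \<le> 2 * matching_number E" using near by presburger
      then have "size_bound k V E"
        unfolding size_bound_def using size' assms(1) by (intro even_order_bound) auto
      then show ?thesis ..
    next
      case False
      obtain x where "x \<in> V" using nonempty by blast
      then have "k + 1 \<le> card V"
        using degree_le_component[OF C, of x] assms(1,4) by (auto simp: regular_graph_def)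
      moreover have "2 * ((int k + 2) * int (card E)) + (int k - 2) * (int (card V) - int k - 1)
        \<le> 2 * (((int k)\<^sup>2 + int k + 2) * int (matching_number E) + (int k - 2) * int (card V))
           + (int k + 2) * (2 - 0)"
        using near size' assms(1) by (intro odd_order_bound) auto
      ultimately show ?thesis using False by simp
    qed
  qed
qed

section \<open>Division by \<open>k^2 + k + 2\<close> and the exceptional orders\<close>

theorem corollary3:
  fixes V :: "'a set" and E :: "'a set set" and k n m :: nat
  assumes "4 \<le> k" and "even k"
    and "fin_simple_graph V E" and "connected_graph V E"
    and "n = card V" and "m = card E"
    and "max_degree V E \<le> k"
  defines "bound \<equiv> (real k + 2) / ((real k)\<^sup>2 + real k + 2) * real m
                  - (real k - 2) / ((real k)\<^sup>2 + real k + 2) * real n"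
  shows "(\<not> (regular_graph k V E \<and> n = k + 1
             \<or> regular_graph k V E \<and> n = k + 3
             \<or> regular_graph 4 V E \<and> n = 9)
          \<longrightarrow> real (matching_number E) \<ge> bound)
     \<and> (regular_graph k V E \<and> n = k + 1
          \<longrightarrow> real (matching_number E) \<ge> bound - (real k + 2) / ((real k)\<^sup>2 + real k + 2))
     \<and> (regular_graph k V E \<and> n = k + 3
          \<longrightarrow> real (matching_number E) \<ge> bound - 4 / ((real k)\<^sup>2 + real k + 2))
     \<and> (regular_graph 4 V E \<and> n = 9
          \<longrightarrow> real (matching_number E) \<ge> bound - 2 / ((real k)\<^sup>2 + real k + 2))"
proof -
  interpret fin_simple_graph V E by fact
  define D where "D = (real k)\<^sup>2 + real k + 2"
  have "0 < D" by (simp add: D_def add_nonneg_pos)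
  \<comment> \<open>The number \<open>s\<close> is the loss in the scaled inequality; each exception
    has its own value.\<close>
  have sb: "real (matching_number E) \<ge> bound - s / D"
    if "(real k + 2) * real m \<le> D * real (matching_number E) + (real k - 2) * real n + s" for s
  proof -
    have "bound - s / D = ((real k + 2) * real m - (real k - 2) * real n - s) / D"
      using \<open>0 < D\<close> unfolding bound_def[folded D_def] by (simp add: field_simps)
    also have "\<dots> \<le> real (matching_number E)"
      using that \<open>0 < D\<close> by (simp add: pos_divide_le_eq mult.commute)
    finally show ?thesis .
  qed
  have plain: "real (matching_number E) \<ge> bound - s / D" if "size_bound k V E" "0 \<le> s" for s
  proof -
    have "real_of_int ((int k + 2) * int m)
      \<le> real_of_int (((int k)\<^sup>2 + int k + 2) * int (matching_number E) + (int k - 2) * int n)"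
      using that(1) assms(5,6) unfolding size_bound_def of_int_le_iff by simp
    then show ?thesis using that(2) by (intro sb) (simp add: D_def)
  qed
  have deg: "degree E v \<le> k" if "v \<in> V" for v
  proof -
    have "degree E v \<le> max_degree V E"
      unfolding max_degree_def using finite_vertices that by (intro Max_ge) auto
    then show ?thesis using assms(7) by simp
  qed
  show ?thesis
  proof (cases "size_bound k V E")
    case True
    then show ?thesis using plain[OF True, of 0] plain[OF True, of "real k + 2"]
        plain[OF True, of 4] plain[OF True, of 2] by (simp add: D_def)
  next
    case False
    then have reg: "regular_graph k V E"
      using connected_not_regular_size_bound assms deg by blast
    then have "odd n" and kn: "k + 1 \<le> n" and
      ineq: "2 * ((int k + 2) * int m) + (int k - 2) * (int n - int k - 1)
        \<le> 2 * (((int k)\<^sup>2 + int k + 2) * int (matching_number E) + (int k - 2) * int n)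
          + 2 * (int k + 2)"
      using connected_regular_size_bound[OF assms(1,2,4)] False assms(5,6) by auto
    have reg4: "k = 4" if "regular_graph 4 V E"
    proof -
      \<comment> \<open>A vertex is needed to compare the two degrees, as regularity is vacuous on
        the empty graph.\<close>
      have "V \<noteq> {}" using kn assms(5) by auto
      then show ?thesis using that reg by (auto simp: regular_graph_def)
    qed
    have "even (n - (k + 1))" using \<open>odd n\<close> assms(2) kn by simp
    then obtain j where "n - (k + 1) = 2 * j" by (rule evenE)
    then have n: "n = k + 1 + 2 * j" using kn by simp
    have "real_of_int (2 * ((int k + 2) * int m) + (int k - 2) * (int n - int k - 1))
        \<le> real_of_int (2 * (((int k)\<^sup>2 + int k + 2) * int (matching_number E) + (int k - 2) * int n)
          + 2 * (int k + 2))"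
      using ineq by (simp only: of_int_le_iff)
    then have "2 * ((real k + 2) * real m) + (real k - 2) * (2 * real j)
        \<le> 2 * (D * real (matching_number E) + (real k - 2) * real n) + 2 * (real k + 2)"
      by (simp add: n D_def)
    \<comment> \<open>The loss is \<open>k + 2\<close> for \<open>j = 0\<close>, \<open>4\<close>
      for \<open>j = 1\<close> and \<open>6 - k\<close> for \<open>j = 2\<close>. The last is
      positive only for \<open>k = 4\<close>, where it is 2 and \<open>n = 9\<close>.\<close>
    then have main: "real (matching_number E) \<ge> bound - ((real k + 2) - (real k - 2) * real j) / D"
      by (intro sb) simp
    have large: "real (matching_number E) \<ge> bound"
      if "(real k + 2) - (real k - 2) * real j \<le> 0"
    proof -
      have "((real k + 2) - (real k - 2) * real j) / D \<le> 0"
        using that \<open>0 < D\<close> by (simp add: divide_nonpos_pos)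
      then show ?thesis using main by linarith
    qed
    have a: "j = 0" if "n = k + 1" using that n by simp
    have b: "j = 1" if "n = k + 3" using that n by simp
    have c: "j = 2" if "k = 4" "n = 9" using that n by simp
    have generic: "real (matching_number E) \<ge> bound"
      if "n \<noteq> k + 1" "n \<noteq> k + 3" "\<not> (k = 4 \<and> n = 9)"
    proof (rule large)
      have "2 \<le> j" using that n by (cases j; cases "j - 1") auto
      show "(real k + 2) - (real k - 2) * real j \<le> 0"
      proof (cases "j = 2")
        case True
        \<comment> \<open>With \<open>j = 2\<close> the value \<open>k = 4\<close> would mean
          \<open>n = 9\<close>, which is excluded, and 5 is odd.\<close>
        then have "6 \<le> k" using that(3) n assms(1,2) by (cases "k = 5") auto
        then show ?thesis using True by simp
      next
        case False
        \<comment> \<open>For \<open>j \<ge> 3\<close> the loss is at most \<open>8 - 2 * k\<close>,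
          which is not positive.\<close>
        then have "(real k - 2) * 3 \<le> (real k - 2) * real j"
          using \<open>2 \<le> j\<close> assms(1) by (intro mult_left_mono) auto
        then show ?thesis using assms(1) by simp
      qed
    qed
    show ?thesis
      unfolding D_def[symmetric]
    proof (intro conjI impI)
      assume "\<not> (regular_graph k V E \<and> n = k + 1 \<or> regular_graph k V E \<and> n = k + 3
        \<or> regular_graph 4 V E \<and> n = 9)"
      then show "real (matching_number E) \<ge> bound" using generic reg by blast
    next
      assume "regular_graph k V E \<and> n = k + 1"
      then show "real (matching_number E) \<ge> bound - (real k + 2) / D" using main a by simp
    next
      assume "regular_graph k V E \<and> n = k + 3"
      then show "real (matching_number E) \<ge> bound - 4 / D" using main b by simp
    next
      assume "regular_graph 4 V E \<and> n = 9"
      then show "real (matching_number E) \<ge> bound - 2 / D" using main c reg4 by simp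
    qed
  qed
qed

end
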